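(* Let $\mu\in M (X)$. Then $$\limsup_{\nu\rightarrow \mu} h_\nu (G, X)\le h_\mu (G, X)+ h^* (G, X).$$ In particular, if $(X, G)$ is asymptotically $h$-expansive then the function $h_\bullet (G, X): M(X)\rightarrow [0,\infty)\cup \{-\infty\}$, $\nu\mapsto h_\nu(G,X)$, is upper semi-continuous.
   Context: Setting: $G$ is a countable discrete sofic group with a fixed sofic approximation $\Sigma=\{\sigma_i: G \rightarrow \mathrm{Sym}(d_i),\ g\mapsto \sigma_{i, g}\}_{i\in \mathbb{N}}$, where $d_i\in\mathbb{N}$, $d_i\to\infty$, $\mathrm{Sym}(d)$ is the permutation group of $\{1,\dots,d\}$, and $\lim_{i} \frac{1}{d_i} |\{a: \sigma_{i,s}\sigma_{i,t}(a)=\sigma_{i,st}(a)\}|=1$ for all $s,t\in G$, $\lim_{i} \frac{1}{d_i} |\{a: \sigma_{i,s}(a)\neq \sigma_{i,t}(a)\}|=1$ for all distinct $s,t\in G$. $G$ acts continuously on a compact metric space $(X,\rho)$. $M(X)$ is the set of Borel probability measures on $X$ with the weak star topology. A function $f:Y\to[-\infty,\infty)$ on a compact metric space $Y$ is upper semi-continuous if $\limsup_{y'\to y}f(y')\le f(y)$ for each $y\in Y$. Conventions: $\log 0=-\infty$; for $r_1,r_2\in[-\infty,\infty]$, $r_1+r_2=-\infty$ if $r_1=-\infty$ or $r_2=-\infty$ (even if the other is $\infty$), and for $r_1,r_2\in(-\infty,\infty]$, $r_1+r_2=\infty$ if one of them is $\infty$. $\mathcal{C}_X$ and $\mathcal{C}_X^o$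 are the sets of finite Borel covers and of finite open covers of $X$. For a cover $\mathcal{V}$ and a set $K$, $N(\mathcal{V},K)$ is the minimal cardinality of sub-families of $\mathcal{V}$ covering $K$ ($N(\mathcal{V},\emptyset)=0$). For $\mathcal{U}\in\mathcal{C}_X$, $\mathcal{U}^d$ is the cover of $X^d$ consisting of all products $U_1\times\cdots\times U_d$ with $U_j\in\mathcal{U}$. $\mathfrak{F}_Y$ is the set of non-empty finite subsets of a set $Y$; $C(X)$ is the set of real-valued continuous functions on $X$. For $F\in\mathfrak{F}_G$, $\delta>0$, $\sigma:G\to\mathrm{Sym}(d)$, put $$X^d_{F,\delta,\sigma}=\left\{(x_1,\dots,x_d)\in X^d:\max_{s\in F}\sqrt{\sum_{j=1}^d\frac1d\rho^2(sx_j,x_{\sigma_s(j)})}<\delta\right\},$$ and for $\mu\in M(X)$, $L\in\mathfrak{F}_{C(X)}$, $$X^d_{F,\delta,\sigma,\mu,L}=\left\{(x_1,\dots,x_d)\in X^d_{F,\delta,\sigma}:\max_{f\in L}\left|\frac1d\sum_{j=1}^df(x_j)-\mu(f)\right|<\delta\right\}.$$ For $\mathcal{U}\in\mathcal{C}_X$ let $$h_\mu(G,\mathcal{U})=\inf_{L\in\mathfrak{F}_{C(X)}}\inf_{F\in\mathfrak{F}_G}\inf_{\delta>0}\limsup_{i\to\infty}\frac1{d_i}\log N\left(\mathcal{U}^{d_i},X^{d_i}_{F,\delta,\sigma_i,\mu,L}\right),$$ and the measure-theoretic $\mu$-entropy is $h_\mu(G,X)=\sup_{\mathcal{U}\in\mathcal{C}_X^o}h_\mu(G,\mathcal{U})$.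 For $\mathcal{U}_1,\mathcal{U}_2\in\mathcal{C}_X$ define $$h(G,\mathcal{U}_1|\mathcal{U}_2)=\inf_{F\in\mathfrak{F}_G}\inf_{\delta>0}\limsup_{i\to\infty}\frac1{d_i}\log\max_{V\in\mathcal{U}_2^{d_i}}N\left(\mathcal{U}_1^{d_i},X^{d_i}_{F,\delta,\sigma_i}\cap V\right),$$ $h(G,X|\mathcal{U}_2)=\sup_{\mathcal{U}_1\in\mathcal{C}_X^o}h(G,\mathcal{U}_1|\mathcal{U}_2)$ and $h^*(G,X)=\inf_{\mathcal{U}_2\in\mathcal{C}_X^o}h(G,X|\mathcal{U}_2)$. $(X,G)$ is asymptotically $h$-expansive if $h^*(G,X)\le0$. *)

theory Defs
  imports
    "HOL-Probability.Probability"
    "HOL-Algebra.Group_Action"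
    "HOL-Algebra.Sym_Groups"
begin

text \<open>Addition on the extended reals in which \<open>-\<infinity>\<close> absorbs everything. It differs from
  the library addition on \<^typ>\<open>ereal\<close> exactly at \<open>\<infinity> + (-\<infinity>)\<close>.\<close>

definition add_minf :: "ereal \<Rightarrow> ereal \<Rightarrow> ereal"  (infixl \<open>\<oplus>\<^sub>-\<close> 65)
  where "a \<oplus>\<^sub>- b = (if a = -\<infinity> \<or> b = -\<infinity> then -\<infinity> else a + b)"

text \<open>Logarithm of a natural number with \<open>log 0 = -\<infinity>\<close> (the library has \<open>ln 0 = 0\<close>).\<close>

definition log_nat :: "nat \<Rightarrow> ereal"
  where "log_nat n = (if n = 0 then -\<infinity> else ereal (ln (real n)))"

definition sofic_approximation ::
    "('g, 'b) monoid_scheme \<Rightarrow> (nat \<Rightarrow> nat) \<Rightarrow> (nat \<Rightarrow> 'g \<Rightarrow> nat \<Rightarrow> nat) \<Rightarrow> bool"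
  where "sofic_approximation G d \<sigma> \<longleftrightarrow>
    filterlim d at_top sequentially \<and>
    (\<forall>i. \<sigma> i \<in> carrier G \<rightarrow> carrier (sym_group (d i))) \<and>
    (\<forall>s\<in>carrier G. \<forall>t\<in>carrier G.
       (\<lambda>i. 1 / real (d i) * real (card {a\<in>{1..d i}. \<sigma> i s (\<sigma> i t a) = \<sigma> i (s \<otimes>\<^bsub>G\<^esub> t) a}))
         \<longlonglongrightarrow> 1) \<and>
    (\<forall>s\<in>carrier G. \<forall>t\<in>carrier G. s \<noteq> t \<longrightarrow>
       (\<lambda>i. 1 / real (d i) * real (card {a\<in>{1..d i}. \<sigma> i s a \<noteq> \<sigma> i t a})) \<longlonglongrightarrow> 1)"

text \<open>The space \<open>X\<close> is the universe of a metric type \<^typ>\<open>'x\<close>, with metric \<^const>\<open>dist\<close>;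
  its compactness is assumed where needed.\<close>

definition continuous_action ::
    "('g, 'b) monoid_scheme \<Rightarrow> ('g \<Rightarrow> 'x::metric_space \<Rightarrow> 'x) \<Rightarrow> bool"
  where "continuous_action G act \<longleftrightarrow>
    group_action G UNIV act \<and> (\<forall>s\<in>carrier G. continuous_on UNIV (act s))"

definition borel_probs :: "'x::metric_space measure set"
  where "borel_probs = {\<nu>. prob_space \<nu> \<and> sets \<nu> = sets borel}"

definition cont_funs :: "('x::metric_space \<Rightarrow> real) set"
  where "cont_funs = {f. continuous_on UNIV f}"

text \<open>The coarsest topology on \<^const>\<open>borel_probs\<close> for which every \<open>\<nu> \<mapsto> \<integral>f d\<nu>\<close> with \<open>f\<close>
  continuous is continuous; taking all of \<open>\<real>\<close> for \<open>W\<close> shows that its underlying set is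
  \<^const>\<open>borel_probs\<close>.\<close>

definition weak_star :: "'x::metric_space measure topology"
  where "weak_star = topology_generated_by
    {{\<nu>\<in>borel_probs. integral\<^sup>L \<nu> f \<in> W} | f W. f \<in> cont_funs \<and> open W}"

definition upper_semicontinuous :: "'y topology \<Rightarrow> ('y \<Rightarrow> ereal) \<Rightarrow> bool"
  where "upper_semicontinuous T f \<longleftrightarrow>
    (\<forall>y\<in>topspace T. f y < \<infinity> \<and> Limsup (atin T y) f \<le> f y)"

definition open_covers :: "'x::metric_space set set set"
  where "open_covers = {U. finite U \<and> (\<forall>A\<in>U. open A) \<and> \<Union>U = UNIV}"

definition cover_number :: "'y set set \<Rightarrow> 'y set \<Rightarrow> nat"
  where "cover_number V K = (LEAST n. \<exists>W\<subseteq>V. finite W \<and> card W = n \<and> K \<subseteq> \<Union>W)"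

text \<open>Points of \<open>X\<^sup>d\<close> are functions on \<open>{1..d}\<close> extended by \<^const>\<open>undefined\<close>.\<close>

definition cover_power :: "nat \<Rightarrow> 'x set set \<Rightarrow> (nat \<Rightarrow> 'x) set set"
  where "cover_power d U = {\<Pi>\<^sub>E j\<in>{1..d}. A j | A. \<forall>j\<in>{1..d}. A j \<in> U}"

definition nonempty_finite_subsets :: "'y set \<Rightarrow> 'y set set"
  where "nonempty_finite_subsets Y = {F. F \<subseteq> Y \<and> finite F \<and> F \<noteq> {}}"

definition top_models ::
    "('g \<Rightarrow> 'x::metric_space \<Rightarrow> 'x) \<Rightarrow> nat \<Rightarrow> 'g set \<Rightarrow> real \<Rightarrow> ('g \<Rightarrow> nat \<Rightarrow> nat) \<Rightarrow> (nat \<Rightarrow> 'x) set"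
  where "top_models act d F \<delta> \<sigma> =
    {x \<in> {1..d} \<rightarrow>\<^sub>E UNIV.
      (MAX s\<in>F. sqrt (\<Sum>j=1..d. 1 / real d * (dist (act s (x j)) (x (\<sigma> s j)))\<^sup>2)) < \<delta>}"

definition meas_models ::
    "('g \<Rightarrow> 'x::metric_space \<Rightarrow> 'x) \<Rightarrow> nat \<Rightarrow> 'g set \<Rightarrow> real \<Rightarrow> ('g \<Rightarrow> nat \<Rightarrow> nat) \<Rightarrow>
     'x measure \<Rightarrow> ('x \<Rightarrow> real) set \<Rightarrow> (nat \<Rightarrow> 'x) set"
  where "meas_models act d F \<delta> \<sigma> \<mu> L =
    {x \<in> top_models act d F \<delta> \<sigma>.
      (MAX f\<in>L. \<bar>1 / real d * (\<Sum>j=1..d. f (x j)) - integral\<^sup>L \<mu> f\<bar>) < \<delta>}"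

definition meas_entropy_cover ::
    "('g, 'b) monoid_scheme \<Rightarrow> (nat \<Rightarrow> nat) \<Rightarrow> (nat \<Rightarrow> 'g \<Rightarrow> nat \<Rightarrow> nat) \<Rightarrow>
     ('g \<Rightarrow> 'x::metric_space \<Rightarrow> 'x) \<Rightarrow> 'x measure \<Rightarrow> 'x set set \<Rightarrow> ereal"
  where "meas_entropy_cover G d \<sigma> act \<mu> U =
    (INF L\<in>nonempty_finite_subsets cont_funs. INF F\<in>nonempty_finite_subsets (carrier G).
      INF \<delta>\<in>{0<..}. limsup (\<lambda>i. ereal (1 / real (d i)) *
        log_nat (cover_number (cover_power (d i) U) (meas_models act (d i) F \<delta> (\<sigma> i) \<mu> L))))"

definition meas_entropy ::
    "('g, 'b) monoid_scheme \<Rightarrow> (nat \<Rightarrow> nat) \<Rightarrow> (nat \<Rightarrow> 'g \<Rightarrow> nat \<Rightarrow> nat) \<Rightarrow>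
     ('g \<Rightarrow> 'x::metric_space \<Rightarrow> 'x) \<Rightarrow> 'x measure \<Rightarrow> ereal"
  where "meas_entropy G d \<sigma> act \<mu> = (SUP U\<in>open_covers. meas_entropy_cover G d \<sigma> act \<mu> U)"

definition cond_entropy_covers ::
    "('g, 'b) monoid_scheme \<Rightarrow> (nat \<Rightarrow> nat) \<Rightarrow> (nat \<Rightarrow> 'g \<Rightarrow> nat \<Rightarrow> nat) \<Rightarrow>
     ('g \<Rightarrow> 'x::metric_space \<Rightarrow> 'x) \<Rightarrow> 'x set set \<Rightarrow> 'x set set \<Rightarrow> ereal"
  where "cond_entropy_covers G d \<sigma> act U1 U2 =
    (INF F\<in>nonempty_finite_subsets (carrier G). INF \<delta>\<in>{0<..}.
      limsup (\<lambda>i. ereal (1 / real (d i)) *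
        log_nat (MAX V\<in>cover_power (d i) U2.
          cover_number (cover_power (d i) U1) (top_models act (d i) F \<delta> (\<sigma> i) \<inter> V))))"

definition cond_entropy ::
    "('g, 'b) monoid_scheme \<Rightarrow> (nat \<Rightarrow> nat) \<Rightarrow> (nat \<Rightarrow> 'g \<Rightarrow> nat \<Rightarrow> nat) \<Rightarrow>
     ('g \<Rightarrow> 'x::metric_space \<Rightarrow> 'x) \<Rightarrow> 'x set set \<Rightarrow> ereal"
  where "cond_entropy G d \<sigma> act U2 = (SUP U1\<in>open_covers. cond_entropy_covers G d \<sigma> act U1 U2)"

definition cond_entropy_star ::
    "('g, 'b) monoid_scheme \<Rightarrow> (nat \<Rightarrow> nat) \<Rightarrow> (nat \<Rightarrow> 'g \<Rightarrow> nat \<Rightarrow> nat) \<Rightarrow>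
     ('g \<Rightarrow> 'x::metric_space \<Rightarrow> 'x) \<Rightarrow> ereal"
  where "cond_entropy_star G d \<sigma> act = (INF U2\<in>open_covers. cond_entropy G d \<sigma> act U2)"

definition asymptotically_h_expansive ::
    "('g, 'b) monoid_scheme \<Rightarrow> (nat \<Rightarrow> nat) \<Rightarrow> (nat \<Rightarrow> 'g \<Rightarrow> nat \<Rightarrow> nat) \<Rightarrow>
     ('g \<Rightarrow> 'x::metric_space \<Rightarrow> 'x) \<Rightarrow> bool"
  where "asymptotically_h_expansive G d \<sigma> act \<longleftrightarrow> cond_entropy_star G d \<sigma> act \<le> 0"

end

theory Submission
  imports Defs
begin

text \<open>A model lying in a member \<open>V\<close> of \<open>\<U>\<^sub>2\<^sup>d\<close> can be covered using few members of
  \<open>\<U>\<^sub>1\<^sup>d\<close>, so \<open>N(\<U>\<^sub>1\<^sup>d, K)\<close> is at most \<open>N(\<U>\<^sub>2\<^sup>d, K)\<close> times the conditional covering number.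
  In the limit this gives \<open>h\<^sub>\<nu>(G, \<U>\<^sub>1) \<le> h\<^sub>\<nu>(G, \<U>\<^sub>2) + h(G, \<U>\<^sub>1|\<U>\<^sub>2)\<close>, hence
  \<open>h\<^sub>\<nu>(G, X) \<le> h\<^sub>\<nu>(G, \<U>\<^sub>2) + h(G, X|\<U>\<^sub>2)\<close> for every \<open>\<nu>\<close>. For a fixed cover \<open>\<U>\<^sub>2\<close> the map
  \<open>\<nu> \<mapsto> h\<^sub>\<nu>(G, \<U>\<^sub>2)\<close> is upper semicontinuous: if \<open>\<nu>\<close> is weak-star close to \<open>\<mu>\<close>, the models of \<open>\<nu>\<close>
  are models of \<open>\<mu>\<close> with \<open>\<delta>\<close> doubled. All quantities are \<open>-\<infinity>\<close> or nonnegative, which makes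
  the extended addition commute with the infima.\<close>

section \<open>Extended reals that are \<open>-\<infinity>\<close> or nonnegative\<close>

text \<open>\<open>log_nat n\<close> is -\<infinity> for \<open>n = 0\<close> and at least 0
  otherwise. The gap below 0 survives every INF, SUP and Limsup, so all entropies stay in this set.
  The value \<infinity> belongs to it because suprema of covers may be infinite.\<close>

definition minf_or_nonneg :: "ereal set"
  where "minf_or_nonneg = {-\<infinity>} \<union> {0..}"

lemma minf_or_nonneg_INF:
  assumes "\<And>i. i \<in> I \<Longrightarrow> f i \<in> minf_or_nonneg"
  shows "(INF i\<in>I. f i) \<in> minf_or_nonneg"
proof (cases "\<exists>i\<in>I. f i = -\<infinity>")
  case True
  then have "(INF i\<in>I. f i) = -\<infinity>"
    by (metis INF_lower ereal_infty_less_eq(2))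
  then show ?thesis by (simp add: minf_or_nonneg_def)
next
  case False
  then have "0 \<le> (INF i\<in>I. f i)"
    using assms by (intro INF_greatest) (auto simp: minf_or_nonneg_def)
  then show ?thesis by (simp add: minf_or_nonneg_def)
qed

lemma minf_or_nonneg_SUP:
  assumes "\<And>i. i \<in> I \<Longrightarrow> f i \<in> minf_or_nonneg"
  shows "(SUP i\<in>I. f i) \<in> minf_or_nonneg"
proof (cases "\<exists>i\<in>I. 0 \<le> f i")
  case True
  then have "0 \<le> (SUP i\<in>I. f i)" by (meson SUP_upper2)
  then show ?thesis by (simp add: minf_or_nonneg_def)
next
  case False
  then have "(SUP i\<in>I. f i) \<le> -\<infinity>"
    using assms by (intro SUP_least) (auto simp: minf_or_nonneg_def)
  then show ?thesis by (simp add: minf_or_nonneg_def)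
qed

lemma minf_or_nonneg_Limsup:
  assumes "\<And>i. f i \<in> minf_or_nonneg"
  shows "Limsup F f \<in> minf_or_nonneg"
  unfolding Limsup_def by (intro minf_or_nonneg_INF minf_or_nonneg_SUP assms)

lemma add_minf_commute: "a \<oplus>\<^sub>- b = b \<oplus>\<^sub>- a"
  by (simp add: add_minf_def add.commute)

lemma add_minf_mono: "a \<le> a' \<Longrightarrow> b \<le> b' \<Longrightarrow> a \<oplus>\<^sub>- b \<le> a' \<oplus>\<^sub>- b'"
  by (auto simp: add_minf_def add_mono)

text \<open>Outside this range the claim fails: with \<open>f i = -i\<close> and
  \<open>c = \<infinity>\<close> every sum is \<infinity>, but the infimum is -\<infinity> and
  absorbs. Within it the infimum is -\<infinity> only if some \<open>f i\<close> is, and then the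
  bound at that index already forces \<open>x\<close> down to -\<infinity>. If \<open>c\<close> is
  -\<infinity>, any index does this, so \<open>I\<close> must be non-empty.\<close>

lemma le_INF_add_minf:
  assumes "I \<noteq> {}" and "\<And>i. i \<in> I \<Longrightarrow> f i \<in> minf_or_nonneg" and "c \<in> minf_or_nonneg"
    and le: "\<And>i. i \<in> I \<Longrightarrow> x \<le> f i \<oplus>\<^sub>- c"
  shows "x \<le> (INF i\<in>I. f i) \<oplus>\<^sub>- c"
proof (cases "c = -\<infinity> \<or> (\<exists>i\<in>I. f i = -\<infinity>)")
  case True
  then have "x \<le> -\<infinity>"
    using le \<open>I \<noteq> {}\<close> by (force simp: add_minf_def)
  then show ?thesis by simp
next
  case False
  then have nonneg: "\<And>i. i \<in> I \<Longrightarrow> 0 \<le> f i" and c: "c \<noteq> -\<infinity>"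
    using assms(2) by (auto simp: minf_or_nonneg_def)
  have "x \<le> (INF i\<in>I. f i + c)"
    using le False by (intro INF_greatest) (auto simp: add_minf_def)
  also have "\<dots> = (INF i\<in>I. f i) + c"
    using \<open>I \<noteq> {}\<close> c nonneg by (rule INF_ereal_add_left)
  also have "\<dots> = (INF i\<in>I. f i) \<oplus>\<^sub>- c"
  proof -
    have "0 \<le> (INF i\<in>I. f i)" using nonneg by (rule INF_greatest)
    then show ?thesis using c by (auto simp: add_minf_def)
  qed
  finally show ?thesis .
qed

section \<open>Exponential growth rates\<close>

lemma log_nat_mono: "m \<le> n \<Longrightarrow> log_nat m \<le> log_nat n"
  by (auto simp: log_nat_def)

lemma log_nat_mult: "log_nat (m * n) = log_nat m + log_nat n"
  by (auto simp: log_nat_def ln_mult)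

text \<open>The common shape of both entropy limsups, so that logarithms and limits are treated
  once, for bare sequences of counts.\<close>

definition growth_rate :: "(nat \<Rightarrow> nat) \<Rightarrow> (nat \<Rightarrow> nat) \<Rightarrow> ereal"
  where "growth_rate d n = limsup (\<lambda>i. ereal (1 / real (d i)) * log_nat (n i))"

lemma growth_rate_mono:
  assumes "\<And>i. m i \<le> n i"
  shows "growth_rate d m \<le> growth_rate d n"
  unfolding growth_rate_def
  by (intro Limsup_mono always_eventually allI ereal_mult_left_mono log_nat_mono assms) simp

lemma growth_rate_minf_or_nonneg: "growth_rate d n \<in> minf_or_nonneg"
  unfolding growth_rate_def
proof (rule minf_or_nonneg_Limsup)
  \<comment> \<open>For \<open>d i = 0\<close> the factor \<open>1 / 0\<close> is 0, and 0 times
    -\<infinity> is 0 in \<open>ereal\<close>, so this case stays in the set too.\<close>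
  show "ereal (1 / real (d i)) * log_nat (n i) \<in> minf_or_nonneg" for i
    by (cases "d i = 0") (auto simp: minf_or_nonneg_def log_nat_def)
qed

lemma growth_rate_less_PInf:
  assumes "filterlim d at_top sequentially" and "k > 0" and le: "\<And>i. n i \<le> k ^ d i"
  shows "growth_rate d n < \<infinity>"
proof -
  have "growth_rate d n \<le> ereal (ln (real k))"
    unfolding growth_rate_def
  proof (rule Limsup_bounded)
    have "eventually (\<lambda>i. 1 \<le> d i) sequentially"
      using assms(1) by (simp add: filterlim_at_top)
    then show "\<forall>\<^sub>F i in sequentially. ereal (1 / real (d i)) * log_nat (n i) \<le> ereal (ln (real k))"
    proof (eventually_elim)
      case (elim i)
      have "log_nat (n i) \<le> log_nat (k ^ d i)"
        by (rule log_nat_mono) (rule le)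
      then have "ereal (1 / real (d i)) * log_nat (n i) \<le> ereal (1 / real (d i)) * log_nat (k ^ d i)"
        by (intro ereal_mult_left_mono) auto
      also have "\<dots> = ereal (ln (real k))"
        using elim \<open>k > 0\<close> by (simp add: log_nat_def ln_realpow)
      finally show ?case .
    qed
  qed
  then show ?thesis by (rule le_less_trans) simp
qed

text \<open>Limsup is subadditive for the library addition. The two finiteness hypotheses exclude
  \<infinity> + (-\<infinity>), the one case in which \<open>add_minf\<close> is smaller.\<close>

lemma growth_rate_mult:
  assumes le: "\<And>i. n i \<le> a i * b i"
    and fin: "growth_rate d a < \<infinity>" "growth_rate d b < \<infinity>"
  shows "growth_rate d n \<le> growth_rate d a \<oplus>\<^sub>- growth_rate d b"
proof -
  have distrib: "ereal (1 / real (d i)) * (log_nat (a i) + log_nat (b i))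
      = ereal (1 / real (d i)) * log_nat (a i) + ereal (1 / real (d i)) * log_nat (b i)" for i
    by (cases "d i = 0") (auto simp: log_nat_def distrib_left)
  have "growth_rate d n \<le> growth_rate d (\<lambda>i. a i * b i)"
    by (rule growth_rate_mono) (rule le)
  also have "\<dots> \<le> growth_rate d a + growth_rate d b"
    unfolding growth_rate_def log_nat_mult distrib by (rule ereal_limsup_add_mono)
  also have "\<dots> = growth_rate d a \<oplus>\<^sub>- growth_rate d b"
    using fin by (auto simp: add_minf_def)
  finally show ?thesis .
qed

section \<open>Covering numbers\<close>

text \<open>Restricting the families \<open>A\<close> to \<open>{1..n}\<close> leaves
  \<open>card U ^ n\<close> of them when \<open>U\<close> is finite. Different families may have the
  same product, for instance if one factor is empty, so this only bounds the cardinality from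
  above.\<close>

lemma cover_power_eq: "cover_power n U = (\<lambda>A. Pi\<^sub>E {1..n} A) ` ({1..n} \<rightarrow>\<^sub>E U)"
proof (intro equalityI subsetI)
  fix V assume "V \<in> cover_power n U"
  then obtain A where "V = Pi\<^sub>E {1..n} A" "\<forall>j\<in>{1..n}. A j \<in> U"
    by (auto simp: cover_power_def)
  then have "V = Pi\<^sub>E {1..n} (restrict A {1..n})" "restrict A {1..n} \<in> {1..n} \<rightarrow>\<^sub>E U"
    by (auto intro!: PiE_cong)
  then show "V \<in> (\<lambda>A. Pi\<^sub>E {1..n} A) ` ({1..n} \<rightarrow>\<^sub>E U)" by blast
next
  fix V assume "V \<in> (\<lambda>A. Pi\<^sub>E {1..n} A) ` ({1..n} \<rightarrow>\<^sub>E U)"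
  then obtain A where "V = Pi\<^sub>E {1..n} A" "A \<in> {1..n} \<rightarrow>\<^sub>E U" by blast
  then show "V \<in> cover_power n U"
    unfolding cover_power_def by blast
qed

lemma finite_cover_power: "finite U \<Longrightarrow> finite (cover_power n U)"
  unfolding cover_power_eq by (intro finite_imageI finite_PiE) auto

lemma card_cover_power_le: "finite U \<Longrightarrow> card (cover_power n U) \<le> card U ^ n"
  unfolding cover_power_eq
  by (rule card_image_le[THEN order_trans]) (auto simp: finite_PiE card_PiE)

lemma cover_power_covers:
  assumes "\<Union>U = UNIV" and "x \<in> {1..n} \<rightarrow>\<^sub>E UNIV"
  shows "x \<in> \<Union>(cover_power n U)"
proof -
  have "\<forall>j. \<exists>A\<in>U. x j \<in> A" using assms(1) by blast
  then obtain A where "\<And>j. A j \<in> U" "\<And>j. x j \<in> A j" by metis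
  then have "Pi\<^sub>E {1..n} A \<in> cover_power n U" "x \<in> Pi\<^sub>E {1..n} A"
    using assms(2) by (auto simp: cover_power_def PiE_iff)
  then show ?thesis by blast
qed

lemma cover_number_le: "W \<subseteq> V \<Longrightarrow> finite W \<Longrightarrow> K \<subseteq> \<Union>W \<Longrightarrow> cover_number V K \<le> card W"
  unfolding cover_number_def by (rule Least_le) blast

lemma cover_number_attained:
  assumes "finite V" and "K \<subseteq> \<Union>V"
  obtains W where "W \<subseteq> V" "finite W" "card W = cover_number V K" "K \<subseteq> \<Union>W"
proof -
  have "\<exists>n. \<exists>W\<subseteq>V. finite W \<and> card W = n \<and> K \<subseteq> \<Union>W"
    using assms by blast
  then have "\<exists>W\<subseteq>V. finite W \<and> card W = cover_number V K \<and> K \<subseteq> \<Union>W"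
    unfolding cover_number_def by (rule LeastI_ex)
  then show ?thesis using that by blast
qed

text \<open>The larger set must be covered by \<open>V\<close>: otherwise the \<open>LEAST\<close>
  in its covering number ranges over nothing and is unspecified.\<close>

lemma cover_number_mono:
  assumes "finite V" and "K' \<subseteq> \<Union>V" and "K \<subseteq> K'"
  shows "cover_number V K \<le> cover_number V K'"
proof -
  obtain W where "W \<subseteq> V" "finite W" "card W = cover_number V K'" "K' \<subseteq> \<Union>W"
    using assms(1,2) by (rule cover_number_attained)
  then show ?thesis
    using cover_number_le[of W V K] assms(3) by (simp add: subset_trans)
qed

text \<open>Refine an optimal \<open>V2\<close>-cover of \<open>K\<close> by an optimal
  \<open>V1\<close>-cover of each piece. The pieces are cut from \<open>T\<close> rather than
  \<open>K\<close> because conditional entropy counts topological models (\<open>T\<close>), while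
  \<open>K\<close> will be the models of a measure.\<close>

lemma cover_number_le_mult:
  assumes "finite V1" "T \<subseteq> \<Union>V1" "finite V2" "K \<subseteq> \<Union>V2" "K \<subseteq> T"
  shows "cover_number V1 K \<le> cover_number V2 K * (MAX V\<in>V2. cover_number V1 (T \<inter> V))"
proof -
  let ?M = "MAX V\<in>V2. cover_number V1 (T \<inter> V)"
  obtain W where W: "W \<subseteq> V2" "finite W" "card W = cover_number V2 K" "K \<subseteq> \<Union>W"
    using assms(3,4) by (rule cover_number_attained)
  have "\<exists>S\<subseteq>V1. finite S \<and> card S = cover_number V1 (T \<inter> V) \<and> T \<inter> V \<subseteq> \<Union>S" for V
  proof -
    have "T \<inter> V \<subseteq> \<Union>V1" using assms(2) by blast
    with assms(1) obtain S where "S \<subseteq> V1" "finite S" "card S = cover_number V1 (T \<inter> V)" "T \<inter> V \<subseteq> \<Union>S"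
      by (rule cover_number_attained)
    then show ?thesis by blast
  qed
  then obtain S where S: "\<And>V. S V \<subseteq> V1" "\<And>V. finite (S V)"
      "\<And>V. card (S V) = cover_number V1 (T \<inter> V)" "\<And>V. T \<inter> V \<subseteq> \<Union>(S V)"
    by metis
  have "cover_number V1 K \<le> card (\<Union>V\<in>W. S V)"
  proof (rule cover_number_le)
    show "K \<subseteq> \<Union>(\<Union>V\<in>W. S V)"
    proof
      fix x assume "x \<in> K"
      then obtain V where "V \<in> W" "x \<in> T \<inter> V" using W(4) assms(5) by blast
      then show "x \<in> \<Union>(\<Union>V\<in>W. S V)" using S(4)[of V] by blast
    qed
  qed (use S(1,2) W(2) in auto)
  also have "\<dots> \<le> (\<Sum>V\<in>W. card (S V))"
    by (rule card_UN_le) (rule W(2))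
  also have "\<dots> \<le> (\<Sum>V\<in>W. ?M)"
    using W(1) assms(3) S(3) by (intro sum_mono) (auto intro!: Max_ge)
  also have "\<dots> = cover_number V2 K * ?M"
    by (simp add: W(3))
  finally show ?thesis .
qed

lemma open_covers_finite_covers:
  assumes "U \<in> open_covers"
  shows "finite U" "\<Union>U = UNIV" "U \<noteq> {}" "card U > 0"
  using assms by (auto simp: open_covers_def card_gt_0_iff)

lemma cover_number_cover_power_le:
  assumes "U \<in> open_covers" and "K \<subseteq> {1..n} \<rightarrow>\<^sub>E UNIV"
  shows "cover_number (cover_power n U) K \<le> card U ^ n"
proof -
  have "finite U" "\<Union>U = UNIV" using assms(1) by (auto simp: open_covers_def)
  moreover have "K \<subseteq> \<Union>(cover_power n U)"
    using assms(2) cover_power_covers[OF \<open>\<Union>U = UNIV\<close>] by blast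
  ultimately have "cover_number (cover_power n U) K \<le> card (cover_power n U)"
    by (intro cover_number_le finite_cover_power order_refl)
  then show ?thesis using card_cover_power_le[OF \<open>finite U\<close>] by (rule order_trans)
qed

section \<open>Models\<close>

lemma top_models_subset_PiE: "top_models act n F \<delta> \<sigma> \<subseteq> {1..n} \<rightarrow>\<^sub>E UNIV"
  by (auto simp: top_models_def)

lemma meas_models_subset_top_models: "meas_models act n F \<delta> \<sigma> \<mu> L \<subseteq> top_models act n F \<delta> \<sigma>"
  by (auto simp: meas_models_def)

lemma top_models_covered:
  assumes "U \<in> open_covers"
  shows "top_models act n F \<delta> \<sigma> \<subseteq> \<Union>(cover_power n U)"
proof
  fix x assume "x \<in> top_models act n F \<delta> \<sigma>"
  then have "x \<in> {1..n} \<rightarrow>\<^sub>E UNIV"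
    using top_models_subset_PiE by (rule rev_subsetD)
  with open_covers_finite_covers(2)[OF assms] show "x \<in> \<Union>(cover_power n U)"
    by (rule cover_power_covers)
qed

lemma meas_models_covered:
  "U \<in> open_covers \<Longrightarrow> meas_models act n F \<delta> \<sigma> \<mu> L \<subseteq> \<Union>(cover_power n U)"
  by (rule subset_trans[OF meas_models_subset_top_models top_models_covered])

text \<open>A maximum over a smaller index set is smaller, provided that set is non-empty, since
  \<open>Max {}\<close> is unspecified.\<close>

lemma top_models_antimono:
  assumes "finite F'" "F \<subseteq> F'" "F \<noteq> {}" "\<delta>' \<le> \<delta>"
  shows "top_models act n F' \<delta>' \<sigma> \<subseteq> top_models act n F \<delta> \<sigma>"
proof
  fix x assume x: "x \<in> top_models act n F' \<delta>' \<sigma>"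
  let ?g = "\<lambda>s. sqrt (\<Sum>j=1..n. 1 / real n * (dist (act s (x j)) (x (\<sigma> s j)))\<^sup>2)"
  have "Max (?g ` F) \<le> Max (?g ` F')"
    using assms(1-3) by (intro Max_mono image_mono finite_imageI) auto
  then show "x \<in> top_models act n F \<delta> \<sigma>"
    using x assms(4) by (simp add: top_models_def)
qed

text \<open>Triangle inequality for the averages. It serves twice: with \<open>\<nu> = \<mu>\<close>
  and \<open>\<epsilon> = 0\<close> it is monotonicity in \<open>F\<close> and \<delta>, and with
  \<epsilon> half of \<delta> it transfers models between nearby measures.\<close>

lemma meas_models_near:
  assumes F: "finite F'" "F \<subseteq> F'" "F \<noteq> {}" and L: "finite L" "L \<noteq> {}"
    and near: "\<And>f. f \<in> L \<Longrightarrow> \<bar>integral\<^sup>L \<nu> f - integral\<^sup>L \<mu> f\<bar> \<le> \<epsilon>"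
    and "0 \<le> \<epsilon>" "\<delta>' + \<epsilon> \<le> \<delta>"
  shows "meas_models act n F' \<delta>' \<sigma> \<nu> L \<subseteq> meas_models act n F \<delta> \<sigma> \<mu> L"
proof
  fix x assume x: "x \<in> meas_models act n F' \<delta>' \<sigma> \<nu> L"
  have "x \<in> top_models act n F \<delta> \<sigma>"
    using x top_models_antimono[OF F, of \<delta>' \<delta>] assms(7,8) by (force simp: meas_models_def)
  moreover have "\<bar>1 / real n * (\<Sum>j=1..n. f (x j)) - integral\<^sup>L \<mu> f\<bar> < \<delta>" if "f \<in> L" for f
  proof -
    have "\<bar>1 / real n * (\<Sum>j=1..n. f (x j)) - integral\<^sup>L \<nu> f\<bar> < \<delta>'"
      using x L that by (simp add: meas_models_def)
    then show ?thesis using near[OF that] assms(8) by linarith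
  qed
  ultimately show "x \<in> meas_models act n F \<delta> \<sigma> \<mu> L"
    using L by (simp add: meas_models_def)
qed

section \<open>Entropy of covers\<close>

text \<open>The entropy of a cover before the infima over \<open>L\<close>, \<open>F\<close> and
  \<delta> are taken; \<open>cond_rate\<close> plays the same role for conditional entropy.\<close>

definition meas_rate ::
    "(nat \<Rightarrow> nat) \<Rightarrow> (nat \<Rightarrow> 'g \<Rightarrow> nat \<Rightarrow> nat) \<Rightarrow> ('g \<Rightarrow> 'x::metric_space \<Rightarrow> 'x) \<Rightarrow> 'x measure \<Rightarrow>
     'x set set \<Rightarrow> ('x \<Rightarrow> real) set \<Rightarrow> 'g set \<Rightarrow> real \<Rightarrow> ereal"
  where "meas_rate d \<sigma> act \<mu> U L F \<delta> =
    growth_rate d (\<lambda>i. cover_number (cover_power (d i) U) (meas_models act (d i) F \<delta> (\<sigma> i) \<mu> L))"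

definition cond_rate ::
    "(nat \<Rightarrow> nat) \<Rightarrow> (nat \<Rightarrow> 'g \<Rightarrow> nat \<Rightarrow> nat) \<Rightarrow> ('g \<Rightarrow> 'x::metric_space \<Rightarrow> 'x) \<Rightarrow>
     'x set set \<Rightarrow> 'x set set \<Rightarrow> 'g set \<Rightarrow> real \<Rightarrow> ereal"
  where "cond_rate d \<sigma> act U1 U2 F \<delta> =
    growth_rate d (\<lambda>i. MAX V\<in>cover_power (d i) U2.
      cover_number (cover_power (d i) U1) (top_models act (d i) F \<delta> (\<sigma> i) \<inter> V))"

lemma meas_entropy_cover_eq:
  "meas_entropy_cover G d \<sigma> act \<mu> U =
    (INF L\<in>nonempty_finite_subsets cont_funs. INF F\<in>nonempty_finite_subsets (carrier G).
      INF \<delta>\<in>{0<..}. meas_rate d \<sigma> act \<mu> U L F \<delta>)"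
  by (simp add: meas_entropy_cover_def meas_rate_def growth_rate_def)

lemma cond_entropy_covers_eq:
  "cond_entropy_covers G d \<sigma> act U1 U2 =
    (INF F\<in>nonempty_finite_subsets (carrier G). INF \<delta>\<in>{0<..}. cond_rate d \<sigma> act U1 U2 F \<delta>)"
  by (simp add: cond_entropy_covers_def cond_rate_def growth_rate_def)

lemma meas_rate_minf_or_nonneg: "meas_rate d \<sigma> act \<mu> U L F \<delta> \<in> minf_or_nonneg"
  unfolding meas_rate_def by (rule growth_rate_minf_or_nonneg)

lemma cond_rate_minf_or_nonneg: "cond_rate d \<sigma> act U1 U2 F \<delta> \<in> minf_or_nonneg"
  unfolding cond_rate_def by (rule growth_rate_minf_or_nonneg)

lemma meas_entropy_cover_minf_or_nonneg: "meas_entropy_cover G d \<sigma> act \<mu> U \<in> minf_or_nonneg"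
  unfolding meas_entropy_cover_eq by (intro minf_or_nonneg_INF meas_rate_minf_or_nonneg)

lemma cond_entropy_covers_minf_or_nonneg: "cond_entropy_covers G d \<sigma> act U1 U2 \<in> minf_or_nonneg"
  unfolding cond_entropy_covers_eq by (intro minf_or_nonneg_INF cond_rate_minf_or_nonneg)

lemma meas_entropy_minf_or_nonneg: "meas_entropy G d \<sigma> act \<mu> \<in> minf_or_nonneg"
  unfolding meas_entropy_def by (intro minf_or_nonneg_SUP meas_entropy_cover_minf_or_nonneg)

lemma cond_entropy_minf_or_nonneg: "cond_entropy G d \<sigma> act U \<in> minf_or_nonneg"
  unfolding cond_entropy_def by (intro minf_or_nonneg_SUP cond_entropy_covers_minf_or_nonneg)

section \<open>Monotonicity and finiteness of the rates\<close>

lemma meas_rate_near_le: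
  assumes "U \<in> open_covers" "finite F'" "F \<subseteq> F'" "F \<noteq> {}" "finite L" "L \<noteq> {}"
    and "\<And>f. f \<in> L \<Longrightarrow> \<bar>integral\<^sup>L \<nu> f - integral\<^sup>L \<mu> f\<bar> \<le> \<epsilon>" "0 \<le> \<epsilon>" "\<delta>' + \<epsilon> \<le> \<delta>"
  shows "meas_rate d \<sigma> act \<nu> U L F' \<delta>' \<le> meas_rate d \<sigma> act \<mu> U L F \<delta>"
  unfolding meas_rate_def
proof (rule growth_rate_mono, rule cover_number_mono)
  fix i
  show "finite (cover_power (d i) U)"
    using assms(1) by (intro finite_cover_power open_covers_finite_covers)
  show "meas_models act (d i) F \<delta> (\<sigma> i) \<mu> L \<subseteq> \<Union>(cover_power (d i) U)"
    using assms(1) by (rule meas_models_covered)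
  show "meas_models act (d i) F' \<delta>' (\<sigma> i) \<nu> L \<subseteq> meas_models act (d i) F \<delta> (\<sigma> i) \<mu> L"
    using assms by (intro meas_models_near)
qed

lemma cond_rate_antimono:
  assumes U: "U1 \<in> open_covers" "U2 \<in> open_covers" and "finite F'" "F \<subseteq> F'" "F \<noteq> {}" "\<delta>' \<le> \<delta>"
  shows "cond_rate d \<sigma> act U1 U2 F' \<delta>' \<le> cond_rate d \<sigma> act U1 U2 F \<delta>"
  unfolding cond_rate_def
proof (rule growth_rate_mono)
  fix i
  let ?V1 = "cover_power (d i) U1" and ?V2 = "cover_power (d i) U2"
  have fin: "finite ?V1" "finite ?V2"
    using U by (auto intro: finite_cover_power open_covers_finite_covers)
  have "cover_number ?V1 (top_models act (d i) F' \<delta>' (\<sigma> i) \<inter> V)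
      \<le> cover_number ?V1 (top_models act (d i) F \<delta> (\<sigma> i) \<inter> V)" for V
  proof (rule cover_number_mono[OF fin(1)])
    show "top_models act (d i) F \<delta> (\<sigma> i) \<inter> V \<subseteq> \<Union>?V1"
      using top_models_covered[OF U(1)] by (rule le_infI1)
    show "top_models act (d i) F' \<delta>' (\<sigma> i) \<inter> V \<subseteq> top_models act (d i) F \<delta> (\<sigma> i) \<inter> V"
      using top_models_antimono[OF assms(3-6)] by blast
  qed
  moreover have "?V2 \<noteq> {}"
    using open_covers_finite_covers(3)[OF U(2)] by (auto simp: cover_power_def)
  ultimately show "(MAX V\<in>?V2. cover_number ?V1 (top_models act (d i) F' \<delta>' (\<sigma> i) \<inter> V))
      \<le> (MAX V\<in>?V2. cover_number ?V1 (top_models act (d i) F \<delta> (\<sigma> i) \<inter> V))"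
    using fin(2) by (simp add: Max_le_iff) (meson Max_ge finite_imageI imageI order_trans)
qed

lemma meas_rate_less_PInf:
  assumes "filterlim d at_top sequentially" and "U \<in> open_covers"
  shows "meas_rate d \<sigma> act \<mu> U L F \<delta> < \<infinity>"
  unfolding meas_rate_def
  using assms(1) open_covers_finite_covers(4)[OF assms(2)]
proof (rule growth_rate_less_PInf)
  show "cover_number (cover_power (d i) U) (meas_models act (d i) F \<delta> (\<sigma> i) \<mu> L) \<le> card U ^ d i" for i
    using meas_models_subset_top_models top_models_subset_PiE
    by (intro cover_number_cover_power_le[OF assms(2)]) (rule subset_trans)
qed

text \<open>The bound behind this, \<open>ln (card U1)\<close>, depends on \<open>U1\<close>; it
  says nothing about the supremum over \<open>U1\<close> in \<open>cond_entropy\<close>.\<close>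

lemma cond_rate_less_PInf:
  assumes "filterlim d at_top sequentially" and U: "U1 \<in> open_covers" "U2 \<in> open_covers"
  shows "cond_rate d \<sigma> act U1 U2 F \<delta> < \<infinity>"
  unfolding cond_rate_def
  using assms(1) open_covers_finite_covers(4)[OF U(1)]
proof (rule growth_rate_less_PInf)
  fix i
  have "cover_number (cover_power (d i) U1) (top_models act (d i) F \<delta> (\<sigma> i) \<inter> V) \<le> card U1 ^ d i" for V
    using top_models_subset_PiE by (intro cover_number_cover_power_le[OF U(1)]) blast
  moreover have "cover_power (d i) U2 \<noteq> {}"
    using open_covers_finite_covers(3)[OF U(2)] by (auto simp: cover_power_def)
  ultimately show "(MAX V\<in>cover_power (d i) U2.
      cover_number (cover_power (d i) U1) (top_models act (d i) F \<delta> (\<sigma> i) \<inter> V)) \<le> card U1 ^ d i"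
    using finite_cover_power[OF open_covers_finite_covers(1)[OF U(2)]] by (auto intro!: Max.boundedI)
qed

text \<open>\<open>cover_number_le_mult\<close> for each \<open>i\<close>, with the models of \<nu>
  as \<open>K\<close> and the topological models as \<open>T\<close>. Both factors grow at a finite
  rate, as \<open>growth_rate_mult\<close> requires.\<close>

lemma meas_rate_le_cond_rate:
  assumes d: "filterlim d at_top sequentially" and U: "U1 \<in> open_covers" "U2 \<in> open_covers"
  shows "meas_rate d \<sigma> act \<nu> U1 L F \<delta> \<le> meas_rate d \<sigma> act \<nu> U2 L F \<delta> \<oplus>\<^sub>- cond_rate d \<sigma> act U1 U2 F \<delta>"
  using meas_rate_less_PInf[OF d U(2), of \<sigma> act \<nu> L F \<delta>] cond_rate_less_PInf[OF d U, of \<sigma> act F \<delta>]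
  unfolding meas_rate_def cond_rate_def
proof (rule growth_rate_mult[rotated])
  fix i
  show "cover_number (cover_power (d i) U1) (meas_models act (d i) F \<delta> (\<sigma> i) \<nu> L)
    \<le> cover_number (cover_power (d i) U2) (meas_models act (d i) F \<delta> (\<sigma> i) \<nu> L) *
      (MAX V\<in>cover_power (d i) U2.
        cover_number (cover_power (d i) U1) (top_models act (d i) F \<delta> (\<sigma> i) \<inter> V))"
    by (intro cover_number_le_mult finite_cover_power open_covers_finite_covers(1) U
        top_models_covered meas_models_covered meas_models_subset_top_models)
qed

section \<open>From rates to entropies\<close>

lemma meas_entropy_cover_le_meas_rate:
  assumes "L \<in> nonempty_finite_subsets cont_funs" "F \<in> nonempty_finite_subsets (carrier G)" "0 < \<delta>"
  shows "meas_entropy_cover G d \<sigma> act \<mu> U \<le> meas_rate d \<sigma> act \<mu> U L F \<delta>"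
  unfolding meas_entropy_cover_eq using assms
  by (auto intro!: INF_lower2[of L] INF_lower2[of F] INF_lower2[of \<delta>])

lemma nonempty_finite_subsets_ne:
  assumes "A \<noteq> {}"
  shows "nonempty_finite_subsets A \<noteq> {}"
proof -
  obtain a where "a \<in> A" using assms by blast
  then have "{a} \<in> nonempty_finite_subsets A" by (simp add: nonempty_finite_subsets_def)
  then show ?thesis by blast
qed

lemma cont_funs_ne: "cont_funs \<noteq> {}"
  by (auto simp: cont_funs_def intro!: exI[of _ "\<lambda>_. 0"])

text \<open>\<open>le_INF_add_minf\<close> once for each of \<open>L\<close>, \<open>F\<close> and
  \<delta>; the inner infima remain in \<open>minf_or_nonneg\<close>, so it applies at every
  level.\<close>

lemma le_meas_entropy_cover_add_minf:
  assumes "carrier G \<noteq> {}" and "c \<in> minf_or_nonneg"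
    and "\<And>L F \<delta>. L \<in> nonempty_finite_subsets cont_funs \<Longrightarrow> F \<in> nonempty_finite_subsets (carrier G) \<Longrightarrow>
      0 < \<delta> \<Longrightarrow> x \<le> meas_rate d \<sigma> act \<mu> U L F \<delta> \<oplus>\<^sub>- c"
  shows "x \<le> meas_entropy_cover G d \<sigma> act \<mu> U \<oplus>\<^sub>- c"
  unfolding meas_entropy_cover_eq using assms
  by (intro le_INF_add_minf nonempty_finite_subsets_ne cont_funs_ne minf_or_nonneg_INF
      meas_rate_minf_or_nonneg) auto

lemma le_add_minf_cond_entropy_covers:
  assumes "carrier G \<noteq> {}" and "c \<in> minf_or_nonneg"
    and "\<And>F \<delta>. F \<in> nonempty_finite_subsets (carrier G) \<Longrightarrow> 0 < \<delta> \<Longrightarrow> x \<le> c \<oplus>\<^sub>- cond_rate d \<sigma> act U1 U2 F \<delta>"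
  shows "x \<le> c \<oplus>\<^sub>- cond_entropy_covers G d \<sigma> act U1 U2"
  unfolding cond_entropy_covers_eq add_minf_commute[of c] using assms
  by (intro le_INF_add_minf nonempty_finite_subsets_ne minf_or_nonneg_INF cond_rate_minf_or_nonneg)
    (auto simp: add_minf_commute)

lemma meas_entropy_cover_le_cond_entropy_covers:
  fixes act :: "'g \<Rightarrow> 'x::metric_space \<Rightarrow> 'x"
  assumes "carrier G \<noteq> {}" and d: "filterlim d at_top sequentially"
    and U: "U1 \<in> open_covers" "U2 \<in> open_covers"
  shows "meas_entropy_cover G d \<sigma> act \<nu> U1
    \<le> meas_entropy_cover G d \<sigma> act \<nu> U2 \<oplus>\<^sub>- cond_entropy_covers G d \<sigma> act U1 U2"
proof (intro le_meas_entropy_cover_add_minf le_add_minf_cond_entropy_covers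
    assms(1) cond_entropy_covers_minf_or_nonneg meas_rate_minf_or_nonneg)
  fix L :: "('x \<Rightarrow> real) set" and F F' and \<delta> \<delta>' :: real
  assume L: "L \<in> nonempty_finite_subsets cont_funs"
    and F: "F \<in> nonempty_finite_subsets (carrier G)" "F' \<in> nonempty_finite_subsets (carrier G)"
    and \<delta>: "0 < \<delta>" "0 < \<delta>'"
  \<comment> \<open>The two infima on the right are independent, but the product inequality needs
    one pair of parameters; both rates only decrease on passing to this common refinement.\<close>
  let ?F = "F \<union> F'" and ?\<delta> = "min \<delta> \<delta>'"
  have fin: "finite ?F" "F \<noteq> {}" "F' \<noteq> {}" "finite L" "L \<noteq> {}"
    using F L by (auto simp: nonempty_finite_subsets_def)
  have "meas_entropy_cover G d \<sigma> act \<nu> U1 \<le> meas_rate d \<sigma> act \<nu> U1 L ?F ?\<delta>"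
    using L F \<delta> by (intro meas_entropy_cover_le_meas_rate) (auto simp: nonempty_finite_subsets_def)
  also have "\<dots> \<le> meas_rate d \<sigma> act \<nu> U2 L ?F ?\<delta> \<oplus>\<^sub>- cond_rate d \<sigma> act U1 U2 ?F ?\<delta>"
    by (rule meas_rate_le_cond_rate[OF d U])
  also have "\<dots> \<le> meas_rate d \<sigma> act \<nu> U2 L F \<delta> \<oplus>\<^sub>- cond_rate d \<sigma> act U1 U2 F' \<delta>'"
    using fin U by (intro add_minf_mono meas_rate_near_le[where \<epsilon>=0] cond_rate_antimono) auto
  finally show "meas_entropy_cover G d \<sigma> act \<nu> U1
    \<le> meas_rate d \<sigma> act \<nu> U2 L F \<delta> \<oplus>\<^sub>- cond_rate d \<sigma> act U1 U2 F' \<delta>'" .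
qed

text \<open>With \<open>U\<close> fixed, only the conditional summand depends on \<open>U1\<close>,
  so the supremum over \<open>U1\<close> passes through the sum.\<close>

lemma meas_entropy_le_cond_entropy:
  fixes act :: "'g \<Rightarrow> 'x::metric_space \<Rightarrow> 'x"
  assumes "carrier G \<noteq> {}" and "filterlim d at_top sequentially" and "U \<in> open_covers"
  shows "meas_entropy G d \<sigma> act \<nu> \<le> meas_entropy_cover G d \<sigma> act \<nu> U \<oplus>\<^sub>- cond_entropy G d \<sigma> act U"
  unfolding meas_entropy_def
proof (rule SUP_least)
  fix U1 :: "'x set set" assume U1: "U1 \<in> open_covers"
  then have "meas_entropy_cover G d \<sigma> act \<nu> U1
      \<le> meas_entropy_cover G d \<sigma> act \<nu> U \<oplus>\<^sub>- cond_entropy_covers G d \<sigma> act U1 U"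
    by (intro meas_entropy_cover_le_cond_entropy_covers assms)
  also have "\<dots> \<le> meas_entropy_cover G d \<sigma> act \<nu> U \<oplus>\<^sub>- cond_entropy G d \<sigma> act U"
    unfolding cond_entropy_def using U1 by (intro add_minf_mono SUP_upper order_refl)
  finally show "meas_entropy_cover G d \<sigma> act \<nu> U1
      \<le> meas_entropy_cover G d \<sigma> act \<nu> U \<oplus>\<^sub>- cond_entropy G d \<sigma> act U" .
qed

lemma meas_entropy_cover_less_PInf:
  assumes "carrier G \<noteq> {}" and "filterlim d at_top sequentially" and "U \<in> open_covers"
  shows "meas_entropy_cover G d \<sigma> act (\<nu> :: 'x::metric_space measure) U < \<infinity>"
proof -
  obtain L F where "L \<in> nonempty_finite_subsets (cont_funs :: ('x \<Rightarrow> real) set)"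
      "F \<in> nonempty_finite_subsets (carrier G)"
    using nonempty_finite_subsets_ne[OF cont_funs_ne] nonempty_finite_subsets_ne[OF assms(1)] by blast
  then have "meas_entropy_cover G d \<sigma> act \<nu> U \<le> meas_rate d \<sigma> act \<nu> U L F 1"
    by (rule meas_entropy_cover_le_meas_rate) simp
  then show ?thesis using meas_rate_less_PInf[OF assms(2,3)] by (rule le_less_trans)
qed

section \<open>Upper semicontinuity\<close>

lemma weak_star_subbasic:
  "f \<in> cont_funs \<Longrightarrow> open W \<Longrightarrow> openin weak_star {\<nu>\<in>borel_probs. integral\<^sup>L \<nu> f \<in> W}"
  unfolding weak_star_def by (rule topology_generated_by_Basis) blast

lemma topspace_weak_star: "topspace weak_star = borel_probs"
proof -
  have "(\<lambda>_. 0) \<in> (cont_funs :: ('x::metric_space \<Rightarrow> real) set)"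
    by (simp add: cont_funs_def)
  from weak_star_subbasic[OF this open_UNIV] have "borel_probs \<subseteq> topspace weak_star"
    by (auto dest: openin_subset)
  moreover have "topspace weak_star \<subseteq> borel_probs"
    unfolding weak_star_def topology_generated_by_topspace by blast
  ultimately show ?thesis by blast
qed

lemma eventually_weak_star_near:
  assumes "L \<in> nonempty_finite_subsets cont_funs" and "\<epsilon> > 0"
  shows "\<forall>\<^sub>F \<nu> in atin weak_star \<mu>. \<forall>f\<in>L. \<bar>integral\<^sup>L \<nu> f - integral\<^sup>L \<mu> f\<bar> < \<epsilon>"
proof (rule eventually_ball_finite)
  show "finite L" using assms(1) by (simp add: nonempty_finite_subsets_def)
  show "\<forall>f\<in>L. \<forall>\<^sub>F \<nu> in atin weak_star \<mu>. \<bar>integral\<^sup>L \<nu> f - integral\<^sup>L \<mu> f\<bar> < \<epsilon>"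
  proof
    fix f assume "f \<in> L"
    then have "f \<in> cont_funs" using assms(1) by (auto simp: nonempty_finite_subsets_def)
    then have "openin weak_star {\<nu>\<in>borel_probs. integral\<^sup>L \<nu> f \<in> ball (integral\<^sup>L \<mu> f) \<epsilon>}"
      (is "openin _ ?W") by (intro weak_star_subbasic) auto
    \<comment> \<open>For \<mu> outside \<open>borel_probs\<close>, which is the underlying set of
      the topology, \<open>eventually_atin\<close> makes the claim vacuous.\<close>
    moreover have "\<mu> \<in> ?W" if "\<mu> \<in> borel_probs"
      using that \<open>\<epsilon> > 0\<close> by simp
    moreover have "\<forall>\<nu>\<in>?W - {\<mu>}. \<bar>integral\<^sup>L \<nu> f - integral\<^sup>L \<mu> f\<bar> < \<epsilon>"
      by (simp add: dist_real_def abs_minus_commute)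
    ultimately show "\<forall>\<^sub>F \<nu> in atin weak_star \<mu>. \<bar>integral\<^sup>L \<nu> f - integral\<^sup>L \<mu> f\<bar> < \<epsilon>"
      unfolding eventually_atin topspace_weak_star by blast
  qed
qed

text \<open>The neighbourhood of \<mu> depends on \<open>L\<close> and \<delta>, so the limsup is
  first bounded for fixed \<open>L\<close>, \<open>F\<close>, \<delta>, and the infimum is taken
  afterwards.\<close>

lemma Limsup_meas_entropy_le:
  fixes act :: "'g \<Rightarrow> 'x::metric_space \<Rightarrow> 'x"
  assumes "carrier G \<noteq> {}" and d: "filterlim d at_top sequentially" and U: "U \<in> open_covers"
  shows "Limsup (atin weak_star \<mu>) (meas_entropy G d \<sigma> act)
    \<le> meas_entropy_cover G d \<sigma> act \<mu> U \<oplus>\<^sub>- cond_entropy G d \<sigma> act U"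
proof (rule le_meas_entropy_cover_add_minf[OF assms(1) cond_entropy_minf_or_nonneg], rule Limsup_bounded)
  fix L :: "('x \<Rightarrow> real) set" and F and \<delta> :: real
  assume L: "L \<in> nonempty_finite_subsets cont_funs" and F: "F \<in> nonempty_finite_subsets (carrier G)"
    and \<delta>: "0 < \<delta>"
  \<comment> \<open>Half of \<delta> pays for the change of integrals from \<nu> to \<mu>, the other
    half is the tolerance left for the models of \<nu>.\<close>
  from L half_gt_zero[OF \<delta>]
  have "\<forall>\<^sub>F \<nu> in atin weak_star \<mu>. \<forall>f\<in>L. \<bar>integral\<^sup>L \<nu> f - integral\<^sup>L \<mu> f\<bar> < \<delta> / 2"
    by (rule eventually_weak_star_near)
  then show "\<forall>\<^sub>F \<nu> in atin weak_star \<mu>. meas_entropy G d \<sigma> act \<nu>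
      \<le> meas_rate d \<sigma> act \<mu> U L F \<delta> \<oplus>\<^sub>- cond_entropy G d \<sigma> act U"
  proof eventually_elim
    case (elim \<nu>)
    have "meas_entropy_cover G d \<sigma> act \<nu> U \<le> meas_rate d \<sigma> act \<nu> U L F (\<delta> / 2)"
      using L F \<delta> by (intro meas_entropy_cover_le_meas_rate) auto
    also have "\<dots> \<le> meas_rate d \<sigma> act \<mu> U L F \<delta>"
      using L F \<delta> U elim
      by (intro meas_rate_near_le[where \<epsilon>="\<delta> / 2"]) (auto simp: nonempty_finite_subsets_def intro: less_imp_le)
    finally have "meas_entropy_cover G d \<sigma> act \<nu> U \<le> meas_rate d \<sigma> act \<mu> U L F \<delta>" .
    then show ?case
      using meas_entropy_le_cond_entropy[OF assms]
      by (meson add_minf_mono order_refl order_trans)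
  qed
qed

section \<open>The infimum over the conditioning cover, and the theorem\<close>

lemma open_covers_ne: "open_covers \<noteq> {}"
proof -
  have "{UNIV} \<in> open_covers" by (simp add: open_covers_def)
  then show ?thesis by blast
qed

lemma Limsup_meas_entropy_le_cond_entropy_star:
  fixes act :: "'g \<Rightarrow> 'x::metric_space \<Rightarrow> 'x"
  assumes "carrier G \<noteq> {}" and "filterlim d at_top sequentially"
  shows "Limsup (atin weak_star \<mu>) (meas_entropy G d \<sigma> act)
    \<le> meas_entropy G d \<sigma> act \<mu> \<oplus>\<^sub>- cond_entropy_star G d \<sigma> act"
  unfolding cond_entropy_star_def add_minf_commute[of "meas_entropy G d \<sigma> act \<mu>"]
proof (rule le_INF_add_minf[OF open_covers_ne cond_entropy_minf_or_nonneg meas_entropy_minf_or_nonneg])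
  fix U :: "'x set set" assume U: "U \<in> open_covers"
  have "Limsup (atin weak_star \<mu>) (meas_entropy G d \<sigma> act)
    \<le> meas_entropy_cover G d \<sigma> act \<mu> U \<oplus>\<^sub>- cond_entropy G d \<sigma> act U"
    by (rule Limsup_meas_entropy_le[OF assms U])
  \<comment> \<open>Enlarging the first summand frees it from \<open>U\<close>, so that the infimum
    over \<open>U\<close> acts on the conditional summand alone.\<close>
  also have "\<dots> \<le> meas_entropy G d \<sigma> act \<mu> \<oplus>\<^sub>- cond_entropy G d \<sigma> act U"
    unfolding meas_entropy_def using U by (intro add_minf_mono SUP_upper order_refl)
  finally show "Limsup (atin weak_star \<mu>) (meas_entropy G d \<sigma> act)
    \<le> cond_entropy G d \<sigma> act U \<oplus>\<^sub>- meas_entropy G d \<sigma> act \<mu>"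
    by (simp add: add_minf_commute)
qed

text \<open>The supremum over covers could be infinite although each cover has finite entropy. A
  finite \<open>cond_entropy_star\<close> supplies one \<open>U\<close> with finite
  \<open>cond_entropy\<close>, which bounds all finer contributions at once.\<close>

lemma meas_entropy_less_PInf:
  assumes "carrier G \<noteq> {}" and "filterlim d at_top sequentially"
    and "cond_entropy_star G d \<sigma> act < \<infinity>"
  shows "meas_entropy G d \<sigma> act \<mu> < \<infinity>"
proof -
  obtain U where U: "U \<in> open_covers" "cond_entropy G d \<sigma> act U < \<infinity>"
    using assms(3) unfolding cond_entropy_star_def INF_less_iff by blast
  have "meas_entropy G d \<sigma> act \<mu> \<le> meas_entropy_cover G d \<sigma> act \<mu> U \<oplus>\<^sub>- cond_entropy G d \<sigma> act U"
    by (rule meas_entropy_le_cond_entropy[OF assms(1,2) U(1)])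
  also have "\<dots> < \<infinity>"
    using meas_entropy_cover_less_PInf[OF assms(1,2) U(1)] U(2) by (auto simp: add_minf_def)
  finally show ?thesis .
qed

theorem theorem3p5:
  fixes G :: "('g, 'b) monoid_scheme"
    and d :: "nat \<Rightarrow> nat"
    and \<sigma> :: "nat \<Rightarrow> 'g \<Rightarrow> nat \<Rightarrow> nat"
    and act :: "'g \<Rightarrow> 'x::metric_space \<Rightarrow> 'x"
  assumes "group G" and "countable (carrier G)"
    and "sofic_approximation G d \<sigma>"
    and "compact (UNIV :: 'x set)"
    and "continuous_action G act"
  shows "(\<forall>\<mu>\<in>borel_probs.
            Limsup (atin weak_star \<mu>) (meas_entropy G d \<sigma> act)
              \<le> meas_entropy G d \<sigma> act \<mu> \<oplus>\<^sub>- cond_entropy_star G d \<sigma> act) \<and>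
         (asymptotically_h_expansive G d \<sigma> act \<longrightarrow>
            meas_entropy G d \<sigma> act \<in> borel_probs \<rightarrow> {0..<\<infinity>} \<union> {-\<infinity>} \<and>
            upper_semicontinuous weak_star (meas_entropy G d \<sigma> act))"
proof (intro conjI impI ballI)
  have G: "carrier G \<noteq> {}"
    using \<open>group G\<close> by (metis empty_iff group.is_monoid monoid.one_closed)
  have d: "filterlim d at_top sequentially"
    using assms(3) by (simp add: sofic_approximation_def)
  show Limsup: "Limsup (atin weak_star \<mu>) (meas_entropy G d \<sigma> act)
      \<le> meas_entropy G d \<sigma> act \<mu> \<oplus>\<^sub>- cond_entropy_star G d \<sigma> act" for \<mu>
    by (rule Limsup_meas_entropy_le_cond_entropy_star[OF G d])
  assume "asymptotically_h_expansive G d \<sigma> act"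
  then have star: "cond_entropy_star G d \<sigma> act \<le> 0"
    by (simp add: asymptotically_h_expansive_def)
  then have "cond_entropy_star G d \<sigma> act < \<infinity>"
    by (rule le_less_trans) simp
  then have fin: "meas_entropy G d \<sigma> act \<mu> < \<infinity>" for \<mu>
    by (rule meas_entropy_less_PInf[OF G d])
  then show "meas_entropy G d \<sigma> act \<in> borel_probs \<rightarrow> {0..<\<infinity>} \<union> {-\<infinity>}"
    using meas_entropy_minf_or_nonneg by (fastforce simp: minf_or_nonneg_def)
  \<comment> \<open>A summand at most 0 cannot raise the sum; if it is -\<infinity>, the left side
    is -\<infinity> as well.\<close>
  have "meas_entropy G d \<sigma> act \<mu> \<oplus>\<^sub>- cond_entropy_star G d \<sigma> act \<le> meas_entropy G d \<sigma> act \<mu>" for \<mu>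
    using add_mono[OF order_refl star, of "meas_entropy G d \<sigma> act \<mu>"] by (auto simp: add_minf_def)
  then show "upper_semicontinuous weak_star (meas_entropy G d \<sigma> act)"
    unfolding upper_semicontinuous_def using Limsup fin by (blast intro: order_trans)
qed

end
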